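(* Right exchanges are terminating on boundary-connected diagrams, and there is a constant $C$ such that every sequence of right exchanges starting from a valid boundary-connected diagram with $n$ vertices has length at most $C n^3$.
   Context: A diagram is a tuple $D=(S,N,H,I,O)$ with $S,N\in\mathbb N$ and $H,I,O:\{0,\dots,N-1\}\to\mathbb N$ ($N$ is the number of vertices); $\Delta(n)=O(n)-I(n)$, $W(0)=S$, $W(n+1)=W(n)+\Delta(n)$; $D$ is valid if $W(n)\ge H(n)+I(n)$ for all $n<N$. Geometrically, the vertex at height $n$ (heights numbered top to bottom) has as inputs the wires $H(n),\dots,H(n)+I(n)-1$ among the $W(n)$ wires crossing level $n$ (numbered left to right) and as outputs the wires $H(n),\dots,H(n)+O(n)-1$ of level $n+1$; wire $k<H(n)$ of level $n$ continues as wire $k$ of level $n+1$ and wire $k\ge H(n)+I(n)$ continues as wire $k+\Delta(n)$. Edges are the resulting maximal wire chains; each joins two vertices, or a vertex and the top boundary (level $0$) or bottom boundary (level $N$), or the two boundaries. The underlying graph has the vertices of $D$ as vertices and the edges joining two vertices as edges. $D$ is boundary-connected if the underlying graph is connected, or every vertex is joined by a path in it to a vertex incident to an edge reaching a boundary. For $0\le n\le N-2$, a right exchange at height $n$ is admissible when $H(n+1)\ge H(n)+O(n)$ and yields $D'$ identical to $D$ except $H'(n)=H(n+1)-\Delta(n)$, $I'(n)=I(n+1)$, $O'(n)=O(n+1)$, $H'(n+1)=H(n)$, $I'(n+1)=I(n)$, $O'(n+1)=O(n)$. *)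

theory Defs
  imports Complex_Main "Graph_Theory.Digraph_Component"
begin

text \<open>
  The fields \<open>dom_wires\<close>, \<open>num_verts\<close>, \<open>offset\<close>, \<open>num_in\<close>, \<open>num_out\<close> are $S$, $N$, $H$, $I$, $O$.
  The last three are total functions; only their values below \<open>num_verts\<close> carry information.
\<close>

record diagram =
  dom_wires :: nat
  num_verts :: nat
  offset :: "nat \<Rightarrow> nat"
  num_in :: "nat \<Rightarrow> nat"
  num_out :: "nat \<Rightarrow> nat"

definition delta :: "diagram \<Rightarrow> nat \<Rightarrow> int" where
  "delta D n = int (num_out D n) - int (num_in D n)"

text \<open>Integer valued, since in an invalid diagram the width may become negative.\<close>

primrec width :: "diagram \<Rightarrow> nat \<Rightarrow> int" where
  "width D 0 = int (dom_wires D)"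
| "width D (Suc n) = width D n + delta D n"

definition valid :: "diagram \<Rightarrow> bool" where
  "valid D \<longleftrightarrow> (\<forall>n < num_verts D. width D n \<ge> int (offset D n) + int (num_in D n))"

text \<open>The pair \<open>(n, k)\<close> stands for wire \<open>k\<close> among those crossing level \<open>n\<close>.\<close>

definition wires :: "diagram \<Rightarrow> (nat \<times> nat) set" where
  "wires D = {(n, k). n \<le> num_verts D \<and> int k < width D n}"

definition inputs :: "diagram \<Rightarrow> nat \<Rightarrow> (nat \<times> nat) set" where
  "inputs D n = {(n, k) | k. offset D n \<le> k \<and> k < offset D n + num_in D n}"

definition outputs :: "diagram \<Rightarrow> nat \<Rightarrow> (nat \<times> nat) set" where
  "outputs D n = {(Suc n, k) | k. offset D n \<le> k \<and> k < offset D n + num_out D n}"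

definition continues :: "diagram \<Rightarrow> nat \<times> nat \<Rightarrow> nat \<times> nat \<Rightarrow> bool" where
  "continues D w w' \<longleftrightarrow> w \<in> wires D \<and> w' \<in> wires D \<and>
     (\<exists>n k k'. w = (n, k) \<and> w' = (Suc n, k') \<and>
        (k < offset D n \<and> k' = k \<or>
         offset D n + num_in D n \<le> k \<and> int k' = int k + delta D n))"

text \<open>
  An edge is a maximal chain of wires, listed from top to bottom. In a valid diagram, its first wire
  is at level 0 or an output of a vertex, and its last wire is at the bottom level or an input of
  a vertex.
\<close>

definition edges :: "diagram \<Rightarrow> (nat \<times> nat) list set" where
  "edges D = {e. e \<noteq> [] \<and> set e \<subseteq> wires D \<and> successively (continues D) e \<and>
     (\<nexists>w. continues D w (hd e)) \<and> (\<nexists>w. continues D (last e) w)}"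

text \<open>
  A multigraph whose arcs are the edges joining two vertices, oriented downwards; the orientation
  is forgotten whenever the graph is used. Outputs of vertex \<open>u\<close> live at level \<open>u + 1\<close> and
  inputs of vertex \<open>v\<close> at level \<open>v\<close>, which determines the end points.
\<close>

definition underlying_graph :: "diagram \<Rightarrow> (nat, (nat \<times> nat) list) pre_digraph" where
  "underlying_graph D =
    \<lparr> verts = {..<num_verts D},
      arcs = {e \<in> edges D. (\<exists>u < num_verts D. hd e \<in> outputs D u) \<and>
                           (\<exists>v < num_verts D. last e \<in> inputs D v)},
      tail = (\<lambda>e. fst (hd e) - 1),
      head = (\<lambda>e. fst (last e)) \<rparr>"

definition boundary_vertex :: "diagram \<Rightarrow> nat \<Rightarrow> bool" where
  "boundary_vertex D v \<longleftrightarrow> v < num_verts D \<and>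
     (\<exists>e \<in> edges D. fst (hd e) = 0 \<and> last e \<in> inputs D v \<or>
                    hd e \<in> outputs D v \<and> fst (last e) = num_verts D)"

text \<open>
  The graph library does not count the empty graph as connected; this is harmless here, because
  the second disjunct holds trivially when there are no vertices.
\<close>

definition boundary_connected :: "diagram \<Rightarrow> bool" where
  "boundary_connected D \<longleftrightarrow>
     Digraph_Component.connected (underlying_graph D) \<or>
     (\<forall>u < num_verts D. \<exists>v. boundary_vertex D v \<and>
        u \<rightarrow>\<^sup>*\<^bsub>with_proj (mk_symmetric (underlying_graph D))\<^esub> v)"

definition right_admissible :: "diagram \<Rightarrow> nat \<Rightarrow> bool" where
  "right_admissible D n \<longleftrightarrow>
     Suc n < num_verts D \<and> offset D (Suc n) \<ge> offset D n + num_out D n"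

text \<open>The argument of \<open>nat\<close> is nonnegative whenever the exchange is admissible.\<close>

definition exchange :: "diagram \<Rightarrow> nat \<Rightarrow> diagram" where
  "exchange D n = D
    \<lparr> offset := (offset D)(n := nat (int (offset D (Suc n)) - delta D n), Suc n := offset D n),
      num_in := (num_in D)(n := num_in D (Suc n), Suc n := num_in D n),
      num_out := (num_out D)(n := num_out D (Suc n), Suc n := num_out D n) \<rparr>"

definition right_exchange :: "diagram \<Rightarrow> diagram \<Rightarrow> bool" where
  "right_exchange D D' \<longleftrightarrow> (\<exists>n. right_admissible D n \<and> D' = exchange D n)"

end

theory Submission
  imports Defs
begin

text \<open>
  Every exchange of \<open>u\<close> and \<open>v\<close> makes them rotate around each other by half a turn, always in the
  same direction. Let \<open>c u v\<close> be the number of these exchanges. For a fixed \<open>u\<close>, compare how often an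
  edge passes the level of \<open>u\<close> on its right and on its left: an exchange of \<open>u\<close> with \<open>v\<close> changes
  the difference by \<open>+1\<close> on the edges leaving \<open>v\<close> and by \<open>-1\<close> on those entering \<open>v\<close>, whichever of
  \<open>u\<close>, \<open>v\<close> is on the left, and no other exchange affects it. For an edge from \<open>a\<close> to \<open>b\<close> the total
  change is thus \<open>c u a - c u b\<close>, and it is at most 2 in absolute value because an edge crosses each
  level at most once. For an edge reaching a boundary only one of the two terms is present. Since
  \<open>c u u = 0\<close>, boundary-connectedness yields \<open>c u v \<le> 2 N\<close>, and \<open>2 k = (\<Sum>u v. c u v) \<le> 2 N\<^sup>3\<close>
  for a sequence of \<open>k\<close> exchanges.
\<close>

section \<open>Labelled wires\<close>

text \<open>
  The label of a wire is the topmost wire of its chain, so that labels on level \<open>n\<close> stand for the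
  edges crossing it; \<open>labels D n\<close> lists them from left to right.
\<close>

primrec labels :: "diagram \<Rightarrow> nat \<Rightarrow> (nat \<times> nat) list" where
  "labels D 0 = map (Pair 0) [0..<dom_wires D]"
| "labels D (Suc n) = take (offset D n) (labels D n)
     @ map (Pair (Suc n)) [offset D n..<offset D n + num_out D n]
     @ drop (offset D n + num_in D n) (labels D n)"

definition out_labels :: "diagram \<Rightarrow> nat \<Rightarrow> (nat \<times> nat) list" where
  "out_labels D n = map (Pair (Suc n)) [offset D n..<offset D n + num_out D n]"

definition in_labels :: "diagram \<Rightarrow> nat \<Rightarrow> (nat \<times> nat) list" where
  "in_labels D n = take (num_in D n) (drop (offset D n) (labels D n))"

definition left_labels :: "diagram \<Rightarrow> nat \<Rightarrow> (nat \<times> nat) list" where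
  "left_labels D n = take (offset D n) (labels D n)"

definition right_labels :: "diagram \<Rightarrow> nat \<Rightarrow> (nat \<times> nat) list" where
  "right_labels D n = drop (offset D n + num_in D n) (labels D n)"

text \<open>In a valid diagram this is the signed incidence matrix: for the label of an edge, 1 at
  the vertex it leaves, -1 at the vertex it enters, 0 elsewhere.\<close>

definition net :: "diagram \<Rightarrow> nat \<Rightarrow> nat \<times> nat \<Rightarrow> int" where
  "net D n l = int (count_list (out_labels D n) l) - int (count_list (in_labels D n) l)"

lemma count_list_map_Pair_upt:
  "count_list (map (Pair a) [i..<j]) l = of_bool (fst l = a \<and> i \<le> snd l \<and> snd l < j)"
  by (induction j) (auto simp: prod_eq_iff)

lemma length_labels:
  assumes "valid D" "n \<le> num_verts D"
  shows "int (length (labels D n)) = width D n"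
  using assms(2)
proof (induction n)
  case (Suc n)
  then have "int (offset D n) + int (num_in D n) \<le> width D n"
    using assms(1) by (auto simp: valid_def)
  with Suc show ?case by (simp add: delta_def)
qed simp

lemma length_in_labels:
  assumes "valid D" "n < num_verts D"
  shows "length (in_labels D n) = num_in D n"
proof -
  have "int (offset D n) + int (num_in D n) \<le> width D n"
    using assms by (auto simp: valid_def)
  then show ?thesis using length_labels[OF assms(1), of n] assms(2)
    by (simp add: in_labels_def)
qed

lemma labels_split:
  "labels D n = left_labels D n @ in_labels D n @ right_labels D n"
  unfolding left_labels_def right_labels_def in_labels_def
  by (metis add.commute append_take_drop_id drop_drop)

lemma labels_Suc_split:
  "labels D (Suc n) = left_labels D n @ out_labels D n @ right_labels D n"
  by (simp add: left_labels_def right_labels_def out_labels_def)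

text \<open>Wires left of the vertex keep their index and those right of it shift by
  \<open>delta\<close>, exactly as the recursion of \<open>labels\<close> moves the dropped
  suffix.\<close>

lemma labels_continues:
  assumes "valid D" "continues D w w'"
  shows "labels D (fst w') ! snd w' = labels D (fst w) ! snd w"
proof -
  obtain n k k' where w: "w = (n, k)" "w' = (Suc n, k')" and W: "w \<in> wires D" "w' \<in> wires D"
    and c: "k < offset D n \<and> k' = k \<or>
         offset D n + num_in D n \<le> k \<and> int k' = int k + delta D n"
    using assms(2) by (auto simp: continues_def)
  have n: "n < num_verts D" using W w by (auto simp: wires_def)
  have len: "k < length (labels D n)" "offset D n + num_in D n \<le> length (labels D n)"
    using W w n length_labels[OF assms(1), of n] assms(1)
    by (auto simp: wires_def valid_def)
  from c show ?thesis
  proof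
    assume "k < offset D n \<and> k' = k"
    with len show ?thesis by (simp add: w nth_append)
  next
    assume a: "offset D n + num_in D n \<le> k \<and> int k' = int k + delta D n"
    then obtain j where "k = offset D n + num_in D n + j" by (auto simp: le_iff_add)
    moreover from this a have "k' = offset D n + num_out D n + j" by (simp add: delta_def)
    ultimately show ?thesis using len by (simp add: w nth_append)
  qed
qed

lemma labels_chain:
  assumes "valid D" "successively (continues D) e" "w \<in> set e"
  shows "labels D (fst w) ! snd w = labels D (fst (hd e)) ! snd (hd e)"
  using assms(2,3)
proof (induction e arbitrary: w)
  case (Cons x xs)
  show ?case
  proof (cases "w = x")
    case False
    with Cons.prems have "w \<in> set xs" "xs \<noteq> []" "continues D x (hd xs)"
      "successively (continues D) xs"
      by (auto simp: successively_Cons)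
    with Cons.IH[of w] labels_continues[OF assms(1)] show ?thesis by simp
  qed simp
qed simp

lemma labels_last:
  assumes "valid D" "e \<in> edges D"
  shows "labels D (fst (last e)) ! snd (last e) = labels D (fst (hd e)) ! snd (hd e)"
  using assms labels_chain[of D e "last e"] by (auto simp: edges_def)

lemma label_top:
  assumes "w \<in> wires D" "fst w = 0"
  shows "labels D (fst w) ! snd w = w"
  using assms by (cases w) (auto simp: wires_def)

lemma label_output:
  assumes "valid D" "u < num_verts D" "w \<in> outputs D u"
  shows "labels D (fst w) ! snd w = w"
proof -
  obtain k where "w = (Suc u, k)" "offset D u \<le> k" "k - offset D u < num_out D u"
    using assms(3) by (auto simp: outputs_def)
  moreover have "offset D u + num_in D u \<le> length (labels D u)"
    using length_labels[OF assms(1), of u] assms(1,2) by (auto simp: valid_def)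
  ultimately show ?thesis by (simp add: nth_append)
qed

lemma label_input:
  assumes "valid D" "v < num_verts D" "w \<in> inputs D v"
  shows "labels D (fst w) ! snd w \<in> set (in_labels D v)"
proof -
  obtain k where k: "w = (v, k)" "offset D v \<le> k" "k < offset D v + num_in D v"
    using assms(3) by (auto simp: inputs_def)
  have "offset D v + num_in D v \<le> length (labels D v)"
    using length_labels[OF assms(1), of v] assms(1,2) by (auto simp: valid_def)
  then have "labels D v ! k = in_labels D v ! (k - offset D v)"
    using k by (simp add: in_labels_def)
  then show ?thesis using k length_in_labels[OF assms(1,2)] by simp
qed

lemma count_out_labels:
  "count_list (out_labels D u) l =
     of_bool (fst l = Suc u \<and> offset D u \<le> snd l \<and> snd l < offset D u + num_out D u)"
  by (simp add: out_labels_def count_list_map_Pair_upt)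

lemma count_out_labels_output:
  assumes "l \<in> outputs D u"
  shows "count_list (out_labels D v) l = of_bool (v = u)"
  using assms by (auto simp: count_out_labels outputs_def)

text \<open>The first component of a label determines its only possible origin: level 0 if it is 0,
  the vertex \<open>u\<close> if it is \<open>Suc u\<close>.\<close>

lemma count_top_plus_out_le:
  "count_list (labels D 0) l + (\<Sum>u<n. count_list (out_labels D u) l) \<le> 1"
proof (cases "fst l")
  case 0
  then show ?thesis by (simp add: count_list_map_Pair_upt count_out_labels)
next
  case (Suc u)
  have "(\<Sum>v<n. count_list (out_labels D v) l) \<le> (\<Sum>v<n. of_bool (v = u))"
    using Suc by (intro sum_mono) (simp add: count_out_labels)
  also have "\<dots> \<le> (1 :: nat)" by (simp add: of_bool_def sum.delta)
  finally show ?thesis using Suc by (simp add: count_list_map_Pair_upt)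
qed

section \<open>Winding numbers along exchange sequences\<close>

text \<open>
  \<open>D'\<close> arises from \<open>D\<close> by exchanges. Vertices are named by their height in \<open>D\<close> and edges by their
  label in \<open>D\<close>; \<open>p i\<close> is the vertex now at height \<open>i\<close>, \<open>L i\<close> lists the edges now crossing level \<open>i\<close>,
  and \<open>A u\<close>, \<open>B u\<close> those now passing to the left and right of \<open>u\<close>.
\<close>

definition tracks :: "diagram \<Rightarrow> diagram \<Rightarrow> (nat \<Rightarrow> (nat \<times> nat) list) \<Rightarrow> (nat \<Rightarrow> nat)
    \<Rightarrow> (nat \<Rightarrow> (nat \<times> nat) list) \<Rightarrow> (nat \<Rightarrow> (nat \<times> nat) list) \<Rightarrow> bool" where
  "tracks D D' L p A B \<longleftrightarrow> num_verts D' = num_verts D \<and>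
     bij_betw p {..<num_verts D} {..<num_verts D} \<and> L 0 = labels D 0 \<and>
     (\<forall>i<num_verts D. offset D' i = length (A (p i)) \<and>
        num_in D' i = length (in_labels D (p i)) \<and> num_out D' i = length (out_labels D (p i)) \<and>
        L i = A (p i) @ in_labels D (p i) @ B (p i) \<and>
        L (Suc i) = A (p i) @ out_labels D (p i) @ B (p i))"

lemma tracks_refl:
  assumes "valid D"
  shows "tracks D D (labels D) id (left_labels D) (right_labels D)"
proof -
  have "length (left_labels D n) = offset D n" if "n < num_verts D" for n
    using length_labels[OF assms, of n] assms that by (auto simp: valid_def left_labels_def)
  moreover have "length (out_labels D n) = num_out D n" for n
    by (simp add: out_labels_def)
  ultimately show ?thesis
    unfolding tracks_def id_def
    using length_in_labels[OF assms]
    by (intro conjI allI impI bij_betw_id[unfolded id_def] refl)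
      (rule labels_split labels_Suc_split | simp)+
qed

text \<open>Passing a vertex replaces its inputs by its outputs, so the count telescopes from the
  top.\<close>

lemma count_tracks_level:
  assumes "tracks D D' L p A B" "i \<le> num_verts D"
  shows "int (count_list (L i) l) = int (count_list (labels D 0) l) + (\<Sum>j<i. net D (p j) l)"
  using assms(2)
proof (induction i)
  case 0
  then show ?case using assms(1) by (simp add: tracks_def)
next
  case (Suc i)
  then have "L i = A (p i) @ in_labels D (p i) @ B (p i)"
    "L (Suc i) = A (p i) @ out_labels D (p i) @ B (p i)"
    using assms(1) by (auto simp: tracks_def)
  then have "int (count_list (L (Suc i)) l) = int (count_list (L i) l) + net D (p i) l"
    by (simp add: net_def)
  with Suc show ?case by simp
qed

text \<open>Even after exchanges an edge crosses each level at most once: ignoring inputs only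
  enlarges the count, and the top together with all outputs contains a label at most once.\<close>

lemma count_tracks_le:
  assumes "tracks D D' L p A B" "u < num_verts D"
  shows "count_list (A u) l + count_list (B u) l \<le> 1"
proof -
  have bij: "bij_betw p {..<num_verts D} {..<num_verts D}"
    using assms(1) by (simp add: tracks_def)
  with assms(2) obtain i where i: "i < num_verts D" "p i = u"
    by (metis bij_betw_imp_surj_on imageE lessThan_iff)
  have "L i = A u @ in_labels D u @ B u" using assms(1) i by (auto simp: tracks_def)
  then have "int (count_list (A u) l + count_list (B u) l) \<le> int (count_list (L i) l)" by simp
  also have "\<dots> = int (count_list (labels D 0) l) + (\<Sum>j<i. net D (p j) l)"
    using count_tracks_level[OF assms(1)] i by simp
  also have "\<dots> \<le> int (count_list (labels D 0) l)
      + (\<Sum>j<i. int (count_list (out_labels D (p j)) l))"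
    by (intro add_left_mono sum_mono) (simp add: net_def)
  \<comment> \<open>Extending the sum to all heights allows reindexing along the bijection
    \<open>p\<close>.\<close>
  also have "\<dots> \<le> int (count_list (labels D 0) l)
      + (\<Sum>j<num_verts D. int (count_list (out_labels D (p j)) l))"
    using i by (intro add_left_mono sum_mono2) auto
  also have "\<dots> = int (count_list (labels D 0) l)
      + (\<Sum>j<num_verts D. int (count_list (out_labels D j) l))"
    using sum.reindex_bij_betw[OF bij, of "\<lambda>j. int (count_list (out_labels D j) l)"] by simp
  also have "\<dots> = int (count_list (labels D 0) l + (\<Sum>j<num_verts D. count_list (out_labels D j) l))"
    by simp
  also have "\<dots> \<le> 1" using count_top_plus_out_le[of D l "num_verts D"] by linarith
  finally show ?thesis by linarith
qed

section \<open>Effect of a single exchange\<close>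

definition side_diff :: "(nat \<Rightarrow> (nat \<times> nat) list) \<Rightarrow> (nat \<Rightarrow> (nat \<times> nat) list)
    \<Rightarrow> nat \<Rightarrow> nat \<times> nat \<Rightarrow> int" where
  "side_diff A B u l = int (count_list (B u) l) - int (count_list (A u) l)"

lemma append_eq_append_longer:
  assumes "xs @ ys = zs @ ts" "length xs \<le> length zs"
  obtains us where "zs = xs @ us" "ys = us @ ts"
  using assms by (fastforce simp: append_eq_append_conv2)

lemma bij_betw_swap_Suc:
  assumes "bij_betw p {..<N} {..<N}" "Suc n < N"
  shows "bij_betw (p(n := p (Suc n), Suc n := p n)) {..<N} {..<N}"
proof -
  have "p(n := p (Suc n), Suc n := p n) ` {..<N} = p ` {..<N}"
    using assms(2) by (auto simp: image_iff)
  moreover have "inj_on (p(n := p (Suc n), Suc n := p n)) {..<N}"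
    using assms by (auto simp: bij_betw_def inj_on_def)
  ultimately show ?thesis using assms(1) by (simp add: bij_betw_def)
qed

text \<open>Here \<open>u\<close> is the upper left vertex and \<open>v\<close> the lower right one.
  The exchange turns inputs of \<open>v\<close> on the right of \<open>u\<close> into outputs of
  \<open>v\<close>, and outputs of \<open>u\<close> on the left of \<open>v\<close> into inputs of
  \<open>u\<close>. Both changes have the same sign in \<open>side_diff\<close>.\<close>

lemma tracks_exchange:
  assumes T: "tracks D D' L p A B" and adm: "right_admissible D' n"
  obtains u v L' p' A' B' where
    "u < num_verts D" "v < num_verts D" "u \<noteq> v" "tracks D (exchange D' n) L' p' A' B'"
    "\<And>x l. side_diff A' B' x l = side_diff A B x l
        + of_bool (x = u) * net D v l + of_bool (x = v) * net D u l"
proof -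
  define u v where "u = p n" and "v = p (Suc n)"
  have N: "Suc n < num_verts D" "num_verts D' = num_verts D"
    and le: "offset D' n + num_out D' n \<le> offset D' (Suc n)"
    using T adm by (auto simp: tracks_def right_admissible_def)
  have bij: "bij_betw p {..<num_verts D} {..<num_verts D}" using T by (simp add: tracks_def)
  then have inj: "p i = p j \<longleftrightarrow> i = j" if "i < num_verts D" "j < num_verts D" for i j
    using that by (auto simp: bij_betw_def inj_on_def)
  have uv: "u < num_verts D" "v < num_verts D" "u \<noteq> v"
    using bij N inj[of n "Suc n"] by (auto simp: u_def v_def bij_betw_def)
  have at: "offset D' i = length (A (p i)) \<and>
        num_in D' i = length (in_labels D (p i)) \<and> num_out D' i = length (out_labels D (p i)) \<and>
        L i = A (p i) @ in_labels D (p i) @ B (p i) \<and>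
        L (Suc i) = A (p i) @ out_labels D (p i) @ B (p i)" if "i < num_verts D" for i
    using T that by (simp add: tracks_def)
  have atu: "offset D' n = length (A u)" "num_in D' n = length (in_labels D u)"
    "num_out D' n = length (out_labels D u)"
    "L n = A u @ in_labels D u @ B u" "L (Suc n) = A u @ out_labels D u @ B u"
    using at[of n] N by (auto simp: u_def)
  have atv: "offset D' (Suc n) = length (A v)" "num_in D' (Suc n) = length (in_labels D v)"
    "num_out D' (Suc n) = length (out_labels D v)"
    "L (Suc n) = A v @ in_labels D v @ B v" "L (Suc (Suc n)) = A v @ out_labels D v @ B v"
    using at[of "Suc n"] N by (auto simp: v_def)
  have "length (A u @ out_labels D u) \<le> length (A v)" using le atu atv by simp
  moreover have "(A u @ out_labels D u) @ B u = A v @ in_labels D v @ B v" using atu atv by simp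
  \<comment> \<open>\<open>M\<close> lists the edges passing between \<open>u\<close> and
    \<open>v\<close>.\<close>
  ultimately obtain M where M: "A v = A u @ out_labels D u @ M" "B u = M @ in_labels D v @ B v"
    by (metis append_eq_append_longer append_assoc)
  \<comment> \<open>Only the level between the two vertices changes: now \<open>v\<close> is already
    passed there, and \<open>u\<close> not yet.\<close>
  define L' where "L' = L(Suc n := A u @ in_labels D u @ M @ out_labels D v @ B v)"
  define p' where "p' = p(n := v, Suc n := u)"
  define A' where "A' = A(v := A u @ in_labels D u @ M)"
  define B' where "B' = B(u := M @ out_labels D v @ B v)"
  have off: "nat (int (offset D' (Suc n)) - delta D' n) = length (A u @ in_labels D u @ M)"
    using atu atv M by (simp add: delta_def)
  have other: "p i \<noteq> u" "p i \<noteq> v" if "i < num_verts D" "i \<noteq> n" "i \<noteq> Suc n" for i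
    using that inj[of i n] inj[of i "Suc n"] N by (auto simp: u_def v_def)
  have "tracks D (exchange D' n) L' p' A' B'"
    unfolding tracks_def
  proof (intro conjI allI impI)
    show "num_verts (exchange D' n) = num_verts D" using N by (simp add: exchange_def)
    show "bij_betw p' {..<num_verts D} {..<num_verts D}"
      unfolding p'_def u_def v_def using bij_betw_swap_Suc[OF bij] N by simp
    show "L' 0 = labels D 0" using T by (simp add: L'_def tracks_def)
  next
    fix i assume i: "i < num_verts D"
    consider "i = n" | "i = Suc n" | "i \<noteq> n" "i \<noteq> Suc n" by blast
    then have "offset (exchange D' n) i = length (A' (p' i)) \<and>
      num_in (exchange D' n) i = length (in_labels D (p' i)) \<and>
      num_out (exchange D' n) i = length (out_labels D (p' i)) \<and>
      L' i = A' (p' i) @ in_labels D (p' i) @ B' (p' i) \<and>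
      L' (Suc i) = A' (p' i) @ out_labels D (p' i) @ B' (p' i)"
    proof cases
      case 1
      then show ?thesis using uv off atu atv M
        by (simp add: exchange_def L'_def p'_def A'_def B'_def)
    next
      case 2
      then show ?thesis using uv atu atv M
        by (simp add: exchange_def L'_def p'_def A'_def B'_def)
    next
      case 3
      then show ?thesis using other[OF i 3] at[OF i]
        by (simp add: exchange_def L'_def p'_def A'_def B'_def)
    qed
    then show "offset (exchange D' n) i = length (A' (p' i))"
      "num_in (exchange D' n) i = length (in_labels D (p' i))"
      "num_out (exchange D' n) i = length (out_labels D (p' i))"
      "L' i = A' (p' i) @ in_labels D (p' i) @ B' (p' i)"
      "L' (Suc i) = A' (p' i) @ out_labels D (p' i) @ B' (p' i)"
      by auto
  qed
  moreover have "side_diff A' B' x l = side_diff A B x l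
        + of_bool (x = u) * net D v l + of_bool (x = v) * net D u l" for x l
    using uv M by (auto simp: side_diff_def A'_def B'_def net_def)
  ultimately show thesis using that uv by blast
qed

text \<open>Each exchange of \<open>u\<close> and \<open>v\<close> adds 1 to both
  \<open>c u v\<close> and \<open>c v u\<close>, whence the total \<open>2 * k\<close>; the diagonal
  stays 0 because the two vertices differ.\<close>

lemma right_exchange_sequence:
  assumes "valid D" "(right_exchange ^^ k) D D'"
  shows "\<exists>L p A B c. tracks D D' L p A B \<and> (\<forall>u. c u u = 0) \<and>
    (\<Sum>u<num_verts D. \<Sum>v<num_verts D. c u v) = 2 * k \<and>
    (\<forall>u l. side_diff A B u l =
       side_diff (left_labels D) (right_labels D) u l
       + (\<Sum>v<num_verts D. int (c u v) * net D v l))"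
  using assms(2)
proof (induction k arbitrary: D')
  case 0
  then have "D' = D" by simp
  with tracks_refl[OF assms(1)]
  have "tracks D D' (labels D) id (left_labels D) (right_labels D)" by simp
  then show ?case
    by - (rule exI, rule exI, rule exI, rule exI, rule exI[of _ "\<lambda>_ _. 0"], rule conjI,
      assumption, simp)
next
  case (Suc k)
  then obtain E n where E: "(right_exchange ^^ k) D E" "right_admissible E n" "D' = exchange E n"
    using right_exchange_def by (metis relpowp_Suc_E)
  from Suc.IH[OF E(1)] obtain L p A B c where T: "tracks D E L p A B" and c0: "\<And>u. c u u = 0"
    and c2: "(\<Sum>u<num_verts D. \<Sum>v<num_verts D. c u v) = 2 * k"
    and w: "\<And>u l. side_diff A B u l =
       side_diff (left_labels D) (right_labels D) u l
       + (\<Sum>v<num_verts D. int (c u v) * net D v l)"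
    by blast
  from tracks_exchange[OF T E(2)] obtain u v L' p' A' B' where
    uv: "u < num_verts D" "v < num_verts D" "u \<noteq> v" and T': "tracks D D' L' p' A' B'"
    and w': "\<And>x l. side_diff A' B' x l = side_diff A B x l
        + of_bool (x = u) * net D v l + of_bool (x = v) * net D u l"
    unfolding E(3) by blast
  define c' where "c' x y = c x y + of_bool (x = u) * of_bool (y = v)
      + of_bool (x = v) * of_bool (y = u)" for x y
  have one: "(\<Sum>y<num_verts D. of_bool (y = a) * f y) = f a" if "a < num_verts D"
    for a and f :: "nat \<Rightarrow> int"
    using that by (simp add: of_bool_def if_distrib[where f = "\<lambda>x. x * _"] sum.delta cong: if_cong)
  have one': "(\<Sum>y<num_verts D. of_bool (y = a)) = (1::nat)" if "a < num_verts D" for a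
    using that by (simp add: of_bool_def sum.delta)
  have "(\<Sum>x<num_verts D. \<Sum>y<num_verts D. c' x y) = 2 * Suc k"
    using uv by (simp add: c'_def sum.distrib c2 one' flip: sum_distrib_left sum_distrib_right)
  moreover have "side_diff A' B' x l =
       side_diff (left_labels D) (right_labels D) x l
       + (\<Sum>y<num_verts D. int (c' x y) * net D y l)" for x l
    using uv by (simp add: w' w c'_def sum.distrib distrib_right mult.assoc one
      flip: sum_distrib_left)
  moreover have "c' x x = 0" for x using uv c0 by (auto simp: c'_def)
  ultimately show ?case using T' by blast
qed

text \<open>The sum is the final minus the initial side difference, and both lie between -1 and
  1.\<close>

lemma exchange_counts:
  assumes "valid D" "(right_exchange ^^ k) D D'"
  obtains c :: "nat \<Rightarrow> nat \<Rightarrow> nat" where "\<And>u. c u u = 0"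
    "(\<Sum>u<num_verts D. \<Sum>v<num_verts D. c u v) = 2 * k"
    "\<And>u l. u < num_verts D \<Longrightarrow> \<bar>\<Sum>v<num_verts D. int (c u v) * net D v l\<bar> \<le> 2"
proof -
  from right_exchange_sequence[OF assms] obtain L p A B c where T: "tracks D D' L p A B"
    and c: "\<And>u. c u u = 0" "(\<Sum>u<num_verts D. \<Sum>v<num_verts D. c u v) = 2 * k"
    and w: "\<And>u l. side_diff A B u l =
       side_diff (left_labels D) (right_labels D) u l + (\<Sum>v<num_verts D. int (c u v) * net D v l)"
    by blast
  have "\<bar>\<Sum>v<num_verts D. int (c u v) * net D v l\<bar> \<le> 2" if "u < num_verts D" for u l
    using w[of u l] count_tracks_le[OF T that, of l]
      count_tracks_le[OF tracks_refl[OF assms(1)] that, of l]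
    unfolding side_diff_def by linarith
  with c that show thesis by blast
qed

section \<open>Distances in the underlying graph\<close>

text \<open>Conservation: what starts at the top or at a vertex ends at a vertex or at the bottom.
  This is the level count at the bottom of \<open>D\<close> itself.\<close>

lemma sum_in_labels:
  assumes "valid D"
  shows "(\<Sum>v<num_verts D. count_list (in_labels D v) l)
      + count_list (labels D (num_verts D)) l
    = count_list (labels D 0) l + (\<Sum>v<num_verts D. count_list (out_labels D v) l)"
proof -
  have "int (count_list (labels D (num_verts D)) l)
    = int (count_list (labels D 0) l) + (\<Sum>j<num_verts D. net D j l)"
    using count_tracks_level[OF tracks_refl[OF assms], of "num_verts D"] by simp
  then show ?thesis
    by (simp add: net_def sum_subtractf flip: of_nat_sum)
qed

section \<open>Incidence of a single edge\<close>

lemma nat_eq_of_bool_if_sum_le_1: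
  fixes f :: "nat \<Rightarrow> nat"
  assumes "(\<Sum>v<n. f v) \<le> 1" "b < n" "f b \<noteq> 0" "v < n"
  shows "f v = of_bool (v = b)"
proof -
  have "(\<Sum>v<n. f v) = f b + (\<Sum>v\<in>{..<n} - {b}. f v)" using assms(2) by (simp add: sum.remove)
  with assms have "f b = 1" "(\<Sum>v\<in>{..<n} - {b}. f v) = 0" by linarith+
  then show ?thesis using assms(4) by auto
qed

text \<open>The label \<open>hd e\<close> is kept along the chain, so it enters \<open>b\<close>,
  and conservation excludes any other vertex that it enters.\<close>

lemma sum_net_arc:
  fixes f :: "nat \<Rightarrow> int"
  assumes "valid D" "e \<in> edges D" "a < num_verts D" "hd e \<in> outputs D a"
    "b < num_verts D" "last e \<in> inputs D b"
  shows "(\<Sum>v<num_verts D. f v * net D v (hd e)) = f a - f b"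
proof -
  let ?l = "hd e"
  have "?l \<in> set (in_labels D b)"
    using label_input[OF assms(1,5,6)] labels_last[OF assms(1,2)] label_output[OF assms(1,3,4)]
    by simp
  then have "count_list (in_labels D b) ?l \<noteq> 0" by (simp add: count_list_0_iff)
  moreover have "(\<Sum>v<num_verts D. count_list (in_labels D v) ?l) \<le> 1"
    using sum_in_labels[OF assms(1), of ?l] count_top_plus_out_le[of D ?l "num_verts D"]
    by linarith
  ultimately have "count_list (in_labels D v) ?l = of_bool (v = b)" if "v < num_verts D" for v
    using nat_eq_of_bool_if_sum_le_1[OF _ assms(5) _ that] by blast
  then have "net D v ?l = of_bool (v = a) - of_bool (v = b)" if "v < num_verts D" for v
    using assms(4) that by (simp add: net_def count_out_labels_output)
  then have "(\<Sum>v<num_verts D. f v * net D v ?l)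
    = (\<Sum>v<num_verts D. f v * (of_bool (v = a) - of_bool (v = b)))" by simp
  also have "\<dots> = f a - f b"
    using assms(3,5) by (simp add: right_diff_distrib sum_subtractf sum.delta)
  finally show ?thesis .
qed

text \<open>No vertex outputs a label of level 0, so only the lower end contributes.\<close>

lemma sum_net_top:
  fixes f :: "nat \<Rightarrow> int"
  assumes "valid D" "e \<in> edges D" "fst (hd e) = 0" "b < num_verts D" "last e \<in> inputs D b"
  shows "(\<Sum>v<num_verts D. f v * net D v (hd e)) = - f b"
proof -
  let ?l = "hd e"
  have "?l \<in> wires D" using assms(2) by (auto simp: edges_def)
  then have "?l \<in> set (in_labels D b)"
    using label_input[OF assms(1,4,5)] labels_last[OF assms(1,2)] label_top assms(3)
    by simp
  then have "count_list (in_labels D b) ?l \<noteq> 0" by (simp add: count_list_0_iff)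
  moreover have "(\<Sum>v<num_verts D. count_list (in_labels D v) ?l) \<le> 1"
    using sum_in_labels[OF assms(1), of ?l] count_top_plus_out_le[of D ?l "num_verts D"]
    by linarith
  ultimately have "count_list (in_labels D v) ?l = of_bool (v = b)" if "v < num_verts D" for v
    using nat_eq_of_bool_if_sum_le_1[OF _ assms(4) _ that] by blast
  then have "net D v ?l = - of_bool (v = b)" if "v < num_verts D" for v
    using assms(3) that by (simp add: net_def count_out_labels)
  then have "(\<Sum>v<num_verts D. f v * net D v ?l)
    = (\<Sum>v<num_verts D. f v * (- of_bool (v = b)))" by simp
  also have "\<dots> = - f b"
    using assms(4) by (simp add: sum_negf)
  finally show ?thesis .
qed

text \<open>The label survives to the bottom, so by conservation it enters no vertex and only the
  upper end contributes.\<close>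

lemma sum_net_bottom:
  fixes f :: "nat \<Rightarrow> int"
  assumes "valid D" "e \<in> edges D" "a < num_verts D" "hd e \<in> outputs D a"
    "fst (last e) = num_verts D"
  shows "(\<Sum>v<num_verts D. f v * net D v (hd e)) = f a"
proof -
  let ?l = "hd e"
  have "last e \<in> wires D" using assms(2) by (auto simp: edges_def)
  then have "snd (last e) < length (labels D (num_verts D))"
    using length_labels[OF assms(1), of "num_verts D"] assms(5)
    by (auto simp: wires_def)
  moreover have "labels D (num_verts D) ! snd (last e) = ?l"
    using labels_last[OF assms(1,2)] label_output[OF assms(1,3,4)] assms(5) by simp
  ultimately have "?l \<in> set (labels D (num_verts D))" by (metis nth_mem)
  then have "count_list (labels D (num_verts D)) ?l \<noteq> 0" by (simp add: count_list_0_iff)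
  then have "(\<Sum>v<num_verts D. count_list (in_labels D v) ?l) = 0"
    using sum_in_labels[OF assms(1), of ?l] count_top_plus_out_le[of D ?l "num_verts D"]
    by linarith
  then have "net D v ?l = of_bool (v = a)" if "v < num_verts D" for v
    using assms(4) that by (simp add: net_def count_out_labels_output)
  then have "(\<Sum>v<num_verts D. f v * net D v ?l) = (\<Sum>v<num_verts D. f v * of_bool (v = a))"
    by simp
  also have "\<dots> = f a" using assms(3) by simp
  finally show ?thesis .
qed

text \<open>
  Bounds \<open>g\<close> by the number of vertices without extracting simple paths: along a path with steps at
  most 1 no intermediate value is skipped.
\<close>

lemma short_steps_fill:
  fixes g :: "'a \<Rightarrow> nat"
  assumes "(x, y) \<in> R\<^sup>*" "g y \<le> 1" "y \<in> V"
    and "\<And>a b. (a, b) \<in> R \<Longrightarrow> a \<in> V \<and> g a \<le> g b + 1"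
  shows "{1..g x} \<subseteq> g ` V"
  using assms(1)
proof (induction rule: converse_rtrancl_induct)
  case base
  have "{1..g y} \<subseteq> {g y}" using assms(2) by auto
  then show ?case using assms(3) by blast
next
  case (step a b)
  have "{1..g a} \<subseteq> insert (g a) {1..g b}" using assms(4)[OF step(1)] by auto
  then show ?case using assms(4)[OF step(1)] step(3) by blast
qed

text \<open>To be applied to \<open>f = c u\<close>. A path leads from \<open>x\<close> either to
  \<open>u\<close>, where \<open>f\<close> vanishes, or to a boundary vertex, where the single term
  of a boundary edge gives \<open>f y \<le> 2\<close>.\<close>

lemma boundary_connected_bound:
  fixes f :: "nat \<Rightarrow> nat"
  assumes "valid D" "boundary_connected D" "u < num_verts D" "f u = 0"
    and bound: "\<And>l. \<bar>\<Sum>v<num_verts D. int (f v) * net D v l\<bar> \<le> 2"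
    and "x < num_verts D"
  shows "f x \<le> 2 * num_verts D"
proof -
  define R where "R = parcs (mk_symmetric (underlying_graph D))"
  \<comment> \<open>Half of \<open>f\<close>, rounded up: steps of at most 2 become steps of at most
    1, an end value of at most 2 becomes at most 1, and \<open>f v \<le> 2 * g v\<close> recovers
    the bound.\<close>
  define g where "g v = (f v + 1) div 2" for v
  have R: "a < num_verts D \<and> g a \<le> g b + 1" if ab: "(a, b) \<in> R" for a b
  proof -
    obtain e s t where e: "e \<in> edges D" "s < num_verts D" "hd e \<in> outputs D s"
      "t < num_verts D" "last e \<in> inputs D t" and st: "(a, b) = (s, t) \<or> (a, b) = (t, s)"
      using ab by (auto simp: R_def parcs_mk_symmetric underlying_graph_def outputs_def inputs_def)
    have "\<bar>int (f s) - int (f t)\<bar> \<le> 2"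
      using bound[of "hd e"] sum_net_arc[OF assms(1) e, of "\<lambda>v. int (f v)"] by simp
    then show ?thesis using st e(2,4) by (auto simp: g_def)
  qed
  have "\<exists>y<num_verts D. (x, y) \<in> R\<^sup>* \<and> f y \<le> 2"
  proof (cases "Digraph_Component.connected (underlying_graph D)")
    case True
    then have "x \<rightarrow>\<^sup>*\<^bsub>with_proj (mk_symmetric (underlying_graph D))\<^esub> u"
      using assms(3,6) by (auto simp: connected_def strongly_connected_def underlying_graph_def)
    then have "(x, u) \<in> R\<^sup>*" by (auto simp: R_def dest: reachable_rtranclI)
    then show ?thesis using assms(3,4) by auto
  next
    case False
    then obtain y where y: "boundary_vertex D y"
      "x \<rightarrow>\<^sup>*\<^bsub>with_proj (mk_symmetric (underlying_graph D))\<^esub> y"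
      using assms(2,6) by (auto simp: boundary_connected_def)
    then have "(x, y) \<in> R\<^sup>*" by (auto simp: R_def dest: reachable_rtranclI)
    moreover obtain e where "e \<in> edges D" "y < num_verts D"
      "fst (hd e) = 0 \<and> last e \<in> inputs D y \<or> hd e \<in> outputs D y \<and> fst (last e) = num_verts D"
      using y(1) by (auto simp: boundary_vertex_def)
    then have "f y \<le> 2"
      using bound[of "hd e"] sum_net_top[OF assms(1), of e y "\<lambda>v. int (f v)"]
        sum_net_bottom[OF assms(1), of e y "\<lambda>v. int (f v)"] by auto
    ultimately show ?thesis using \<open>y < num_verts D\<close> by blast
  qed
  then obtain y where "y < num_verts D" "(x, y) \<in> R\<^sup>*" "f y \<le> 2" by blast
  then have "{1..g x} \<subseteq> g ` {..<num_verts D}"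
    using short_steps_fill[of x y R g "{..<num_verts D}"] R by (auto simp: g_def)
  then have "card {1..g x} \<le> card {..<num_verts D}"
    by (rule surj_card_le[rotated]) simp
  then show ?thesis by (simp add: g_def)
qed

section \<open>Cubic bound and termination\<close>

lemma num_right_exchanges_le:
  assumes "valid D" "boundary_connected D" "(right_exchange ^^ k) D D'"
  shows "k \<le> num_verts D ^ 3"
proof -
  obtain c :: "nat \<Rightarrow> nat \<Rightarrow> nat" where c: "\<And>u. c u u = 0"
    "(\<Sum>u<num_verts D. \<Sum>v<num_verts D. c u v) = 2 * k"
    "\<And>u l. u < num_verts D \<Longrightarrow> \<bar>\<Sum>v<num_verts D. int (c u v) * net D v l\<bar> \<le> 2"
    using exchange_counts[OF assms(1,3)] by blast
  have "2 * k \<le> (\<Sum>u<num_verts D. \<Sum>v<num_verts D. 2 * num_verts D)"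
    unfolding c(2)[symmetric]
    using boundary_connected_bound[OF assms(1,2)] c(1,3) by (intro sum_mono) auto
  then show ?thesis by (simp add: power3_eq_cube)
qed

text \<open>Every successor of \<open>x\<close> satisfies the hypothesis with a bound smaller by 1,
  and for bound 0 there is no successor.\<close>

lemma termip_if_bounded:
  assumes "\<And>k y. (R ^^ k) x y \<Longrightarrow> k \<le> n"
  shows "termip R x"
  using assms
proof (induction n arbitrary: x)
  case 0
  have "\<not> R x y" for y using 0[of 1 y] by auto
  then show ?case by - (rule accp.accI, erule conversepE, blast)
next
  case (Suc n)
  have "termip R y" if "R x y" for y
  proof (rule Suc.IH)
    fix k z assume "(R ^^ k) y z"
    then have "(R ^^ Suc k) x z" using that relpowp_Suc_I2 by fast
    then show "k \<le> n" using Suc.prems by fastforce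
  qed
  then show ?case by - (rule accp.accI, erule conversepE, blast)
qed

theorem theorem36:
  shows "(\<forall>D. valid D \<longrightarrow> boundary_connected D \<longrightarrow> termip right_exchange D) \<and>
    (\<exists>C::real. \<forall>D D' k. valid D \<longrightarrow> boundary_connected D \<longrightarrow> (right_exchange ^^ k) D D' \<longrightarrow>
       real k \<le> C * real (num_verts D) ^ 3)"
proof (intro conjI exI[of _ 1] allI impI)
  fix D assume "valid D" "boundary_connected D"
  then show "termip right_exchange D"
    using termip_if_bounded[of right_exchange D "num_verts D ^ 3"] num_right_exchanges_le by blast
next
  fix D D' k assume "valid D" "boundary_connected D" "(right_exchange ^^ k) D D'"
  then have "k \<le> num_verts D ^ 3" by (rule num_right_exchanges_le)
  then show "real k \<le> 1 * real (num_verts D) ^ 3"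
    by (simp flip: of_nat_power)
qed

end
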